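(* Let $n\ge 2$, let $\Sigma=\Sigma_1\uplus\cdots\uplus\Sigma_n$ be a finite alphabet partitioned into pairwise disjoint location alphabets, let $\mathcal{A}$ be an NFA over $\Sigma$ with a unique initial state, and let $(\mu_1,\ldots,\mu_n)$ be a multitrace, i.e. $\mu_i\in\Sigma_i^*$ for every $i\in\{1,\ldots,n\}$. Then the semi-centralized procedure (defined in the context) run on $\mathcal{A}$ and $(\mu_i)_{i=1}^n$ is (sound) if it sends an error message ($\texttt{LocalError}(i)$ for some $i$, $\texttt{InterError}$, or $\texttt{CentralError}$), then no interleaving of $\mu_1,\ldots,\mu_n$ is accepted by $\mathcal{A}$, i.e. $(\mu_1\mathbin{\sqcup\!\sqcup}\cdots\mathbin{\sqcup\!\sqcup}\mu_n)\cap\mathcal{L}(\mathcal{A})=\emptyset$; and (complete) if no interleaving of $\mu_1,\ldots,\mu_n$ is accepted by $\mathcal{A}$, then it sends an error message.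
   Context: An NFA is $\mathcal{A}=(Q,\Sigma,\delta,Q_0,F)$ with finite state set $Q$, finite alphabet $\Sigma$, transitions $\delta\subseteq Q\times\Sigma\times Q$ (no $\varepsilon$-transitions), initial states $Q_0$, final states $F$; $\delta(q,a)$ is the set of states reachable from $q$ by one $a$-transition and $\delta(S,a)=\bigcup_{q\in S}\delta(q,a)$. $\mathcal{L}(\mathcal{A})$ is the set of words read by an accepting path (from an initial to a final state). Shuffle: for languages $L_1,L_2$ over $\Sigma_1,\Sigma_2$, $L_1\mathbin{\sqcup\!\sqcup} L_2$ is the set of words $u_1v_1\ldots u_kv_k$ with $u_j\in\Sigma_1^*$, $v_j\in\Sigma_2^*$, $u_1\ldots u_k\in L_1$, $v_1\ldots v_k\in L_2$; extended to $n$ languages by iteration. A word $\mu_i$ is identified with $\{\mu_i\}$, so $\mu_1\mathbin{\sqcup\!\sqcup}\cdots\mathbin{\sqcup\!\sqcup}\mu_n$ is the set of interleavings of the $\mu_i$. Let $\mathcal{A}=(Q,\Sigma,\delta,\{q_0\},F)$. The sub-automaton of $\mathcal{A}$ defined by a set $\delta'\subseteq\delta$ of transitions is the NFA over $\Sigma$ with transitions $\delta'$, whose state set $Q'$ is the set of states occurring as source or target of a transition of $\delta'$, with initial states $\{q_0\}\cap Q'$ and final states $F\cap Q'$. Fix a location $i$ and put $\Sigma_{\bar\imath}=\Sigma\setminus\Sigma_i$. Let $\delta_{\bar\imath}(q)$ be the set of states reachable from $q$ in $\mathcal{A}$ by reading a (possibly empty) word of $\Sigma_{\bar\imath}^*$,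 and $\delta_{\bar\imath}(S)=\bigcup_{q\in S}\delta_{\bar\imath}(q)$. Let $\Delta_{\bar\imath}(q)=\delta\cap\{q'\xrightarrow{b}q''\mid q',q''\in\delta_{\bar\imath}(q),\,b\in\Sigma_{\bar\imath}\}$ and $\Delta(q,a)=\{q\xrightarrow{a}q'\mid q'\in\delta(q,a)\}$, extended to sets $S$ of states by union. - $\mathsf{Proj}(\mathcal{A},\Sigma_i)$ is the DFA over $\Sigma_i$ with state set $2^Q$, transitions $S\xrightarrow{a}S'$ iff $S'=\delta_{\bar\imath}(\delta(S,a))$ for $a\in\Sigma_i$, initial state $\delta_{\bar\imath}(q_0)$, and final states $\{S\mid S\cap F\ne\emptyset\}$. - For a transition $t=S\xrightarrow{a}S'$ of $\mathsf{Proj}(\mathcal{A},\Sigma_i)$, $\mathsf{area}(t)$ is the sub-automaton of $\mathcal{A}$ defined by the transitions $\Delta(S,a)\cup\Delta_{\bar\imath}(\delta(S,a))$. - $\mathsf{init}$ is the sub-automaton of $\mathcal{A}$ defined by the transitions $\Delta_{\bar\imath}(q_0)$, with the convention that $q_0$ always belongs to its state set (and is final in it iff $q_0\in F$). - For $\mu_i\in\Sigma_i^*$ with $t_1,\ldots,t_k$ the unique path of $\mathsf{Proj}(\mathcal{A},\Sigma_i)$ reading $\mu_i$ from its initial state, $\mathsf{Area}(\mu_i)$ is the NFA over $\Sigma$ with initial state $q_0$ whose states, transitions and final states are the unions of those of $\mathsf{init},\mathsf{area}(t_1),\ldots,\mathsf{area}(t_k)$. $\mathsf{Inter}(\mathcal{A},(\mu_i)_i)$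 is the NFA over $\Sigma$ with initial state $q_0$ whose states, transitions and final states are the intersections over $i=1,\ldots,n$ of those of $\mathsf{Area}(\mu_i)$. For an NFA $\mathcal{B}=(Q^{\mathcal{B}},\Sigma,\delta^{\mathcal{B}},\{q_0^{\mathcal{B}}\},F^{\mathcal{B}})$, $\mathsf{Central}(\mathcal{B},(\mu_i)_i)$ is the NFA over $\Sigma$ with states $\mathsf{suf}(\mu_1)\times\cdots\times\mathsf{suf}(\mu_n)\times Q^{\mathcal{B}}$ ($\mathsf{suf}(w)$ being the set of suffixes of $w$, including $w$ and the empty word $\varepsilon$), transitions $(w_1,\ldots,w_n,q)\xrightarrow{a}(w_1',\ldots,w_n',q')$ iff $q'\in\delta^{\mathcal{B}}(q,a)$ and there is $i$ with $w_i=aw_i'$ and $w_j=w_j'$ for all $j\neq i$, initial state $(\mu_1,\ldots,\mu_n,q_0^{\mathcal{B}})$, and final states $\{(\varepsilon,\ldots,\varepsilon,q)\mid q\in F^{\mathcal{B}}\}$. Semi-centralized procedure on $\mathcal{A}$ and $(\mu_i)_i$: 1. Local checks: for each $i$, read $\mu_i$ on $\mathsf{Proj}(\mathcal{A},\Sigma_i)$. If $\mu_i$ is not accepted, send $\texttt{LocalError}(i)$ and stop the procedure; otherwise send $\mathsf{Area}(\mu_i)$ to the central verifier. 2. Central check: construct $\mathsf{Inter}=\mathsf{Inter}(\mathcal{A},(\mu_i)_i)$. If it has no accepting path, send $\texttt{InterError}$ and stop. Otherwise build the states of $\mathsf{Central}(\mathsf{Inter},(\mu_i)_i)$ reachable from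 its initial state; answer $\texttt{Pass}$ if one of them (possibly the initial state itself) is final, and $\texttt{CentralError}$ otherwise. *)

theory Defs
  imports Main "HOL-Library.FuncSet" "HOL-Library.Disjoint_Sets" "HOL-Library.Sublist"
begin

section \<open>Nondeterministic finite automata\<close>

record ('q, 'a) nfa =
  states :: "'q set"
  alphabet :: "'a set"
  delta :: "('q \<times> 'a \<times> 'q) set"
  initials :: "'q set"
  finals :: "'q set"

definition wf_nfa :: "('q, 'a) nfa \<Rightarrow> bool" where
  "wf_nfa A \<longleftrightarrow>
     finite (states A) \<and> finite (alphabet A) \<and>
     delta A \<subseteq> states A \<times> alphabet A \<times> states A \<and>
     initials A \<subseteq> states A \<and> finals A \<subseteq> states A"

text \<open>Only meaningful for automata with exactly one initial state.\<close>

definition init_state :: "('q, 'a) nfa \<Rightarrow> 'q" where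
  "init_state A = the_elem (initials A)"

definition source :: "'q \<times> 'a \<times> 'q \<Rightarrow> 'q" where
  "source t = fst t"

definition letter :: "'q \<times> 'a \<times> 'q \<Rightarrow> 'a" where
  "letter t = fst (snd t)"

definition target :: "'q \<times> 'a \<times> 'q \<Rightarrow> 'q" where
  "target t = snd (snd t)"

text \<open>A path is the list of the transitions it takes.\<close>

fun is_path :: "('q, 'a) nfa \<Rightarrow> 'q \<Rightarrow> ('q \<times> 'a \<times> 'q) list \<Rightarrow> 'q \<Rightarrow> bool" where
  "is_path A p [] q \<longleftrightarrow> p = q"
| "is_path A p (t # ts) q \<longleftrightarrow> t \<in> delta A \<and> source t = p \<and> is_path A (target t) ts q"

definition accepting_path :: "('q, 'a) nfa \<Rightarrow> ('q \<times> 'a \<times> 'q) list \<Rightarrow> bool" where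
  "accepting_path A ts \<longleftrightarrow> (\<exists>p\<in>initials A. \<exists>q\<in>finals A. is_path A p ts q)"

definition language :: "('q, 'a) nfa \<Rightarrow> 'a list set" where
  "language A = {map letter ts | ts. accepting_path A ts}"

definition reachable :: "('q, 'a) nfa \<Rightarrow> 'q set" where
  "reachable A = {q. \<exists>p\<in>initials A. \<exists>ts. is_path A p ts q}"

definition post :: "('q, 'a) nfa \<Rightarrow> 'q \<Rightarrow> 'a \<Rightarrow> 'q set" where
  "post A q a = {q'. (q, a, q') \<in> delta A}"

definition post_set :: "('q, 'a) nfa \<Rightarrow> 'q set \<Rightarrow> 'a \<Rightarrow> 'q set" where
  "post_set A S a = (\<Union>q\<in>S. post A q a)"


section \<open>Shuffle of languages\<close>

definition shuffle :: "'a list set \<Rightarrow> 'a list set \<Rightarrow> 'a list set" where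
  "shuffle L1 L2 =
     {concat (map2 (@) us vs) | us vs.
        length us = length vs \<and> concat us \<in> L1 \<and> concat vs \<in> L2}"

definition interleavings :: "nat \<Rightarrow> (nat \<Rightarrow> 'a list) \<Rightarrow> 'a list set" where
  "interleavings n \<mu> = foldr shuffle (map (\<lambda>i. {\<mu> i}) [1..<Suc n]) {[]}"

lemma concat_map2_append_in_shuffles:
  assumes "length us = length vs"
  shows "concat (map2 (@) us vs) \<in> shuffles (concat us) (concat vs)"
proof -
  have prep: "u @ v @ w \<in> shuffles (u @ x) (v @ y)" if "w \<in> shuffles x y"
    for u v w x y :: "'a list"
  proof (induction u)
    case Nil
    have "v @ w \<in> shuffles x (v @ y)"
      using that by (induction v) (auto intro: Cons_in_shuffles_rightI)
    then show ?case by simp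
  qed (auto intro: Cons_in_shuffles_leftI)
  show ?thesis
    using assms by (induction us vs rule: list_induct2) (simp_all add: prep)
qed

lemma in_shuffles_imp_concat_map2_append:
  "w \<in> shuffles u v \<Longrightarrow>
     \<exists>us vs. length us = length vs \<and> concat us = u \<and> concat vs = v \<and> w = concat (map2 (@) us vs)"
proof (induction w arbitrary: u v)
  case Nil
  then have "u = []" "v = []" by auto
  then show ?case by (intro exI[of _ "[]"]) simp
next
  case (Cons x w)
  from Cons.prems consider
      (l) u' where "u = x # u'" "w \<in> shuffles u' v"
    | (r) v' where "v = x # v'" "w \<in> shuffles u v'"
    by (cases u; cases v) (auto simp: Cons_in_shuffles_iff)
  then show ?case
  proof cases
    case l
    with Cons.IH obtain us vs where
      "length us = length vs" "concat us = u'" "concat vs = v" "w = concat (map2 (@) us vs)"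
      by blast
    with l show ?thesis by (intro exI[of _ "[x] # us"] exI[of _ "[] # vs"]) simp
  next
    case r
    with Cons.IH obtain us vs where
      "length us = length vs" "concat us = u" "concat vs = v'" "w = concat (map2 (@) us vs)"
      by blast
    with r show ?thesis by (intro exI[of _ "[] # us"] exI[of _ "[x] # vs"]) simp
  qed
qed

lemma shuffle_eq_UN_shuffles: "shuffle L1 L2 = (\<Union>u\<in>L1. \<Union>v\<in>L2. shuffles u v)"
  using concat_map2_append_in_shuffles in_shuffles_imp_concat_map2_append
  unfolding shuffle_def by fastforce


section \<open>Sub-automata and projections\<close>

definition endpoints :: "('q \<times> 'a \<times> 'q) set \<Rightarrow> 'q set" where
  "endpoints T = source ` T \<union> target ` T"

definition sub_automaton :: "('q, 'a) nfa \<Rightarrow> ('q \<times> 'a \<times> 'q) set \<Rightarrow> ('q, 'a) nfa" where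
  "sub_automaton A T =
     \<lparr>states = endpoints T, alphabet = alphabet A, delta = T,
      initials = initials A \<inter> endpoints T, finals = finals A \<inter> endpoints T\<rparr>"

text \<open>
  In the following, \<open>S\<^sub>i\<close> is the alphabet of one location; the primitives named \<open>hidden\<close>
  refer to the letters of the other locations.
\<close>

definition hidden_reach :: "('q, 'a) nfa \<Rightarrow> 'a set \<Rightarrow> 'q \<Rightarrow> 'q set" where
  "hidden_reach A S\<^sub>i q =
     {q'. \<exists>ts. is_path A q ts q' \<and> map letter ts \<in> lists (alphabet A - S\<^sub>i)}"

definition hidden_reach_set :: "('q, 'a) nfa \<Rightarrow> 'a set \<Rightarrow> 'q set \<Rightarrow> 'q set" where
  "hidden_reach_set A S\<^sub>i S = (\<Union>q\<in>S. hidden_reach A S\<^sub>i q)"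

definition hidden_trans :: "('q, 'a) nfa \<Rightarrow> 'a set \<Rightarrow> 'q \<Rightarrow> ('q \<times> 'a \<times> 'q) set" where
  "hidden_trans A S\<^sub>i q =
     delta A \<inter> hidden_reach A S\<^sub>i q \<times> (alphabet A - S\<^sub>i) \<times> hidden_reach A S\<^sub>i q"

definition hidden_trans_set :: "('q, 'a) nfa \<Rightarrow> 'a set \<Rightarrow> 'q set \<Rightarrow> ('q \<times> 'a \<times> 'q) set" where
  "hidden_trans_set A S\<^sub>i S = (\<Union>q\<in>S. hidden_trans A S\<^sub>i q)"

definition letter_trans :: "('q, 'a) nfa \<Rightarrow> 'q \<Rightarrow> 'a \<Rightarrow> ('q \<times> 'a \<times> 'q) set" where
  "letter_trans A q a = {(q, a, q') | q'. q' \<in> post A q a}"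

definition letter_trans_set :: "('q, 'a) nfa \<Rightarrow> 'q set \<Rightarrow> 'a \<Rightarrow> ('q \<times> 'a \<times> 'q) set" where
  "letter_trans_set A S a = (\<Union>q\<in>S. letter_trans A q a)"

definition proj :: "('q, 'a) nfa \<Rightarrow> 'a set \<Rightarrow> ('q set, 'a) nfa" where
  "proj A S\<^sub>i =
     \<lparr>states = Pow (states A), alphabet = S\<^sub>i,
      delta = {(S, a, S'). S \<in> Pow (states A) \<and> a \<in> S\<^sub>i \<and>
                           S' = hidden_reach_set A S\<^sub>i (post_set A S a)},
      initials = {hidden_reach A S\<^sub>i (init_state A)},
      finals = {S \<in> Pow (states A). S \<inter> finals A \<noteq> {}}\<rparr>"

definition proj_path :: "('q, 'a) nfa \<Rightarrow> 'a set \<Rightarrow> 'a list \<Rightarrow> ('q set \<times> 'a \<times> 'q set) list" where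
  "proj_path A S\<^sub>i w =
     (THE ts. (\<exists>S. is_path (proj A S\<^sub>i) (init_state (proj A S\<^sub>i)) ts S) \<and> map letter ts = w)"

lemma is_path_states:
  "wf_nfa A \<Longrightarrow> is_path A p ts q \<Longrightarrow> p \<in> states A \<Longrightarrow> q \<in> states A"
  by (induction ts arbitrary: p) (auto simp: wf_nfa_def target_def)

lemma hidden_reach_subset: "wf_nfa A \<Longrightarrow> q \<in> states A \<Longrightarrow> hidden_reach A S\<^sub>i q \<subseteq> states A"
  unfolding hidden_reach_def using is_path_states by fastforce

text \<open>The path picked by the definite description in \<^const>\<open>proj_path\<close> exists and is unique.\<close>

lemma proj_path_ex1:
  assumes wf: "wf_nfa A" and init: "initials A = {q0}" and w: "w \<in> lists S\<^sub>i"
  shows "\<exists>!ts. (\<exists>S. is_path (proj A S\<^sub>i) (init_state (proj A S\<^sub>i)) ts S) \<and> map letter ts = w"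
proof -
  have "\<exists>!ts. (\<exists>S'. is_path (proj A S\<^sub>i) S ts S') \<and> map letter ts = w" if "S \<subseteq> states A" for S
    using w that
  proof (induction w arbitrary: S)
    case Nil
    have "is_path (proj A S\<^sub>i) S [] S" by simp
    then show ?case by blast
  next
    case (Cons a w)
    define S' where "S' = hidden_reach_set A S\<^sub>i (post_set A S a)"
    have "post_set A S a \<subseteq> states A"
      using wf by (auto simp: post_set_def post_def wf_nfa_def)
    then have "S' \<subseteq> states A"
      using hidden_reach_subset[OF wf] by (fastforce simp: S'_def hidden_reach_set_def)
    with Cons have ex1: "\<exists>!ts. (\<exists>S''. is_path (proj A S\<^sub>i) S' ts S'') \<and> map letter ts = w"
      by auto
    have step: "t \<in> delta (proj A S\<^sub>i) \<and> source t = S \<and> letter t = a \<longleftrightarrow> t = (S, a, S')" for t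
      using Cons by (cases t) (auto simp: proj_def source_def letter_def S'_def)
    have cons: "(\<exists>S''. is_path (proj A S\<^sub>i) S ts S'') \<and> map letter ts = a # w \<longleftrightarrow>
          (\<exists>ts'. ts = (S, a, S') # ts' \<and>
             (\<exists>S''. is_path (proj A S\<^sub>i) S' ts' S'') \<and> map letter ts' = w)" for ts
    proof (cases ts)
      case (Cons t ts')
      then show ?thesis using step[of t] by (auto simp: target_def)
    qed simp
    have "\<exists>!ts. \<exists>ts'. ts = (S, a, S') # ts' \<and> P ts'" if "\<exists>!ts'. P ts'" for P
      using that by metis
    from this[OF ex1] show ?case unfolding cons .
  qed
  moreover have "init_state (proj A S\<^sub>i) \<subseteq> states A"
    using hidden_reach_subset[OF wf, of q0] wf init
    by (simp add: proj_def init_state_def wf_nfa_def)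
  ultimately show ?thesis by blast
qed


section \<open>Areas\<close>

definition area_of_trans ::
  "('q, 'a) nfa \<Rightarrow> 'a set \<Rightarrow> 'q set \<times> 'a \<times> 'q set \<Rightarrow> ('q, 'a) nfa" where
  "area_of_trans A S\<^sub>i t =
     sub_automaton A
       (letter_trans_set A (source t) (letter t) \<union>
        hidden_trans_set A S\<^sub>i (post_set A (source t) (letter t)))"

definition init_area :: "('q, 'a) nfa \<Rightarrow> 'a set \<Rightarrow> ('q, 'a) nfa" where
  "init_area A S\<^sub>i =
     (let T = hidden_trans A S\<^sub>i (init_state A);
          Q' = insert (init_state A) (endpoints T)
      in \<lparr>states = Q', alphabet = alphabet A, delta = T,
          initials = {init_state A}, finals = finals A \<inter> Q'\<rparr>)"

definition area_of_word :: "('q, 'a) nfa \<Rightarrow> 'a set \<Rightarrow> 'a list \<Rightarrow> ('q, 'a) nfa" where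
  "area_of_word A S\<^sub>i w =
     (let parts = insert (init_area A S\<^sub>i) (area_of_trans A S\<^sub>i ` set (proj_path A S\<^sub>i w))
      in \<lparr>states = (\<Union>P\<in>parts. states P), alphabet = alphabet A,
          delta = (\<Union>P\<in>parts. delta P),
          initials = {init_state A}, finals = (\<Union>P\<in>parts. finals P)\<rparr>)"

definition inter_nfa ::
  "('q, 'a) nfa \<Rightarrow> nat \<Rightarrow> (nat \<Rightarrow> 'a set) \<Rightarrow> (nat \<Rightarrow> 'a list) \<Rightarrow> ('q, 'a) nfa" where
  "inter_nfa A n \<Sigma> \<mu> =
     \<lparr>states = (\<Inter>i\<in>{1..n}. states (area_of_word A (\<Sigma> i) (\<mu> i))),
      alphabet = alphabet A,
      delta = (\<Inter>i\<in>{1..n}. delta (area_of_word A (\<Sigma> i) (\<mu> i))),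
      initials = {init_state A},
      finals = (\<Inter>i\<in>{1..n}. finals (area_of_word A (\<Sigma> i) (\<mu> i)))\<rparr>"


section \<open>The central automaton\<close>

text \<open>
  A tuple \<open>(w\<^sub>1, \<dots>, w\<^sub>n)\<close> is an extensional function on \<open>{1..n}\<close>.
\<close>

definition central_nfa ::
  "('q, 'a) nfa \<Rightarrow> nat \<Rightarrow> (nat \<Rightarrow> 'a list) \<Rightarrow> ((nat \<Rightarrow> 'a list) \<times> 'q, 'a) nfa" where
  "central_nfa B n \<mu> =
     (let Q = (\<Pi>\<^sub>E i\<in>{1..n}. {v. suffix v (\<mu> i)}) \<times> states B
      in \<lparr>states = Q, alphabet = alphabet B,
          delta = {((w, q), a, (w', q')). (w, q) \<in> Q \<and> (w', q') \<in> Q \<and> q' \<in> post B q a \<and>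
                     (\<exists>i\<in>{1..n}. w i = a # w' i \<and> (\<forall>j\<in>{1..n}. j \<noteq> i \<longrightarrow> w j = w' j))},
          initials = {(restrict \<mu> {1..n}, init_state B)},
          finals = {(\<lambda>i\<in>{1..n}. []) } \<times> finals B\<rparr>)"


section \<open>The semi-centralized procedure\<close>

datatype verdict = LocalError nat | InterError | CentralError | Pass

definition is_error :: "verdict \<Rightarrow> bool" where
  "is_error v \<longleftrightarrow> (\<exists>i. v = LocalError i) \<or> v = InterError \<or> v = CentralError"

definition central_check ::
  "('q, 'a) nfa \<Rightarrow> nat \<Rightarrow> (nat \<Rightarrow> 'a set) \<Rightarrow> (nat \<Rightarrow> 'a list) \<Rightarrow> verdict" where
  "central_check A n \<Sigma> \<mu> =
     (let I = inter_nfa A n \<Sigma> \<mu>; C = central_nfa I n \<mu>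
      in if \<not> (\<exists>ts. accepting_path I ts) then InterError
         else if reachable C \<inter> finals C \<noteq> {} then Pass
         else CentralError)"

text \<open>
  The order of the local checks is not fixed: any failing location may be the one whose error
  is sent and stops the procedure, so the procedure is a relation between input and verdict.
\<close>

inductive semi_centralized ::
  "('q, 'a) nfa \<Rightarrow> nat \<Rightarrow> (nat \<Rightarrow> 'a set) \<Rightarrow> (nat \<Rightarrow> 'a list) \<Rightarrow> verdict \<Rightarrow> bool"
  for A n \<Sigma> \<mu>
where
  local_error:
    "i \<in> {1..n} \<Longrightarrow> \<mu> i \<notin> language (proj A (\<Sigma> i)) \<Longrightarrow> semi_centralized A n \<Sigma> \<mu> (LocalError i)"
| central:
    "(\<And>i. i \<in> {1..n} \<Longrightarrow> \<mu> i \<in> language (proj A (\<Sigma> i))) \<Longrightarrow>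
     semi_centralized A n \<Sigma> \<mu> (central_check A n \<Sigma> \<mu>)"

lemma semi_centralized_total: "\<exists>v. semi_centralized A n \<Sigma> \<mu> v"
  by (meson semi_centralized.intros)

end

theory Submission
  imports Defs
begin

text \<open>
  Let \<open>ts\<close> be an accepting path of \<open>\<A>\<close> that reads an interleaving. Erasing the letters outside
  \<open>\<Sigma>\<^sub>i\<close> leaves \<open>\<mu>\<^sub>i\<close>, and following \<open>ts\<close> in the determinized projection shows that \<open>\<mu>\<^sub>i\<close> is
  accepted there and that every transition of \<open>ts\<close> lies in the area of \<open>\<mu>\<^sub>i\<close>. Hence restricting
  \<open>\<A>\<close> to the intersection of the areas loses no such path, and the central automaton, which
  consumes the \<open>\<mu>\<^sub>i\<close> letter by letter, reads exactly the interleavings.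
\<close>

section \<open>Interleavings of a family of words\<close>

text \<open>The index list and the family are separate parameters: inductions can run over the list,
  while the family is updated at one index when a letter is consumed.\<close>

definition interleave :: "'i list \<Rightarrow> ('i \<Rightarrow> 'a list) \<Rightarrow> 'a list set" where
  "interleave is f = foldr shuffle (map (\<lambda>i. {f i}) is) {[]}"

lemma interleavings_eq: "interleavings n \<mu> = interleave [1..<Suc n] \<mu>"
  by (simp only: interleavings_def interleave_def)

lemma interleave_simps [simp]:
  "interleave [] f = {[]}"
  "interleave (i # is) f = (\<Union>v\<in>interleave is f. shuffles (f i) v)"
  by (simp_all add: interleave_def shuffle_eq_UN_shuffles)

lemma interleave_cong:
  "(\<And>i. i \<in> set is \<Longrightarrow> f i = g i) \<Longrightarrow> interleave is f = interleave is g"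
  by (induction "is") auto

lemma Nil_in_interleave_iff: "[] \<in> interleave is f \<longleftrightarrow> (\<forall>i\<in>set is. f i = [])"
  by (induction "is") auto

text \<open>Reading the first letter shortens exactly one component, the same move as a transition
  of the central automaton. Distinctness matters because \<open>f(i := v)\<close> would alter every
  occurrence of a repeated index.\<close>

lemma Cons_in_interleave_iff:
  assumes "distinct is"
  shows "a # w \<in> interleave is f \<longleftrightarrow>
    (\<exists>i\<in>set is. \<exists>v. f i = a # v \<and> w \<in> interleave is (f(i := v)))"
  using assms
proof (induction "is" arbitrary: w)
  case Nil
  then show ?case by simp
next
  case (Cons k ks)
  have head: "interleave ks (f(k := v)) = interleave ks f" for v
    using Cons.prems by (intro interleave_cong) auto
  \<comment> \<open>The first letter comes either from the word of \<open>k\<close> or from an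
    interleaving of the remaining words.\<close>
  have "a # w \<in> interleave (k # ks) f \<longleftrightarrow>
      (\<exists>v. f k = a # v \<and> w \<in> interleave (k # ks) (f(k := v))) \<or>
      (\<exists>x. a # x \<in> interleave ks f \<and> w \<in> shuffles (f k) x)"
    unfolding interleave_simps UN_iff Cons_in_shuffles_iff head fun_upd_same
    by (fastforce simp: neq_Nil_conv)
  moreover have "(\<exists>x. a # x \<in> interleave ks f \<and> w \<in> shuffles (f k) x) \<longleftrightarrow>
      (\<exists>i\<in>set ks. \<exists>v. f i = a # v \<and> w \<in> interleave (k # ks) (f(i := v)))"
  proof -
    have "w \<in> interleave (k # ks) (f(i := v)) \<longleftrightarrow>
        (\<exists>x\<in>interleave ks (f(i := v)). w \<in> shuffles (f k) x)" if "i \<in> set ks" for i v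
    proof -
      have "(f(i := v)) k = f k" using Cons.prems that by auto
      then show ?thesis unfolding interleave_simps UN_iff by (simp only:)
    qed
    moreover have "a # x \<in> interleave ks f \<longleftrightarrow>
        (\<exists>i\<in>set ks. \<exists>v. f i = a # v \<and> x \<in> interleave ks (f(i := v)))" for x
      using Cons.prems by (intro Cons.IH) simp
    ultimately show ?thesis by blast
  qed
  ultimately show ?case by (simp del: interleave_simps fun_upd_apply)
qed

text \<open>Induction on the interleaving: a letter taken from component \<open>j\<close> lies in
  \<open>\<Sigma> j\<close>, so by disjointness the filter for \<open>i\<close> keeps it exactly
  when \<open>i = j\<close>.\<close>

lemma filter_interleave:
  assumes "w \<in> interleave is f" "distinct is" "disjoint_family_on \<Sigma> (set is)"
    and "\<And>i. i \<in> set is \<Longrightarrow> f i \<in> lists (\<Sigma> i)" "i \<in> set is"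
  shows "filter (\<lambda>a. a \<in> \<Sigma> i) w = f i"
  using assms
proof (induction w arbitrary: f)
  case Nil
  then show ?case by (simp add: Nil_in_interleave_iff)
next
  case (Cons a w)
  then obtain j v where j: "j \<in> set is" "f j = a # v" "w \<in> interleave is (f(j := v))"
    by (auto simp: Cons_in_interleave_iff)
  then have av: "a \<in> \<Sigma> j" "v \<in> lists (\<Sigma> j)"
    using Cons.prems(4)[of j] by auto
  have "filter (\<lambda>a. a \<in> \<Sigma> i) w = (f(j := v)) i"
  proof (rule Cons.IH[OF j(3) Cons.prems(2,3) _ Cons.prems(5)])
    show "(f(j := v)) k \<in> lists (\<Sigma> k)" if "k \<in> set is" for k
      using Cons.prems(4)[OF that] av(2) by simp
  qed
  moreover have "a \<in> \<Sigma> i \<longleftrightarrow> i = j"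
    using av j Cons.prems(3,5) by (auto simp: disjoint_family_on_def)
  ultimately show ?case using j by auto
qed

section \<open>Paths and their runs in the projection\<close>

lemma triple_simps [simp]:
  "source (p, a, q) = p" "letter (p, a, q) = a" "target (p, a, q) = q"
  by (simp_all add: source_def letter_def target_def)

lemma is_path_append:
  "is_path A p (ts @ us) q \<longleftrightarrow> (\<exists>r. is_path A p ts r \<and> is_path A r us q)"
  by (induction ts arbitrary: p) auto

lemma is_path_mono: "is_path A p ts q \<Longrightarrow> set ts \<subseteq> delta B \<Longrightarrow> is_path B p ts q"
  by (induction ts arbitrary: p) auto

lemma is_path_delta: "is_path A p ts q \<Longrightarrow> set ts \<subseteq> delta A"
  by (induction ts arbitrary: p) auto

lemma is_path_end: "is_path A p ts q \<Longrightarrow> q \<in> insert p (endpoints (set ts))"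
  by (induction ts arbitrary: p) (auto simp: endpoints_def)

lemma subset_hidden_reach_set: "R \<subseteq> hidden_reach_set A \<Gamma> R"
proof
  fix q assume "q \<in> R"
  moreover have "is_path A q [] q" by simp
  ultimately show "q \<in> hidden_reach_set A \<Gamma> R"
    unfolding hidden_reach_set_def hidden_reach_def by (force intro: exI[of _ "[]"])
qed

lemma hidden_reach_step:
  assumes "q \<in> hidden_reach A \<Gamma> r" "t \<in> delta A" "source t = q" "letter t \<in> alphabet A - \<Gamma>"
  shows "target t \<in> hidden_reach A \<Gamma> r"
proof -
  obtain ts where "is_path A r ts q" "map letter ts \<in> lists (alphabet A - \<Gamma>)"
    using assms(1) by (auto simp: hidden_reach_def)
  then have "is_path A r (ts @ [t]) (target t)" "map letter (ts @ [t]) \<in> lists (alphabet A - \<Gamma>)"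
    using assms by (auto simp: is_path_append)
  then show ?thesis unfolding hidden_reach_def by blast
qed

lemma hidden_reach_set_states:
  "wf_nfa A \<Longrightarrow> R \<subseteq> states A \<Longrightarrow> hidden_reach_set A \<Gamma> R \<subseteq> states A"
  using hidden_reach_subset by (fastforce simp: hidden_reach_set_def)

text \<open>The area of a transition collects hidden moves starting right after its visible letter.
  The invariant therefore keeps these seeds \<open>R\<close>; their hidden closure is the current
  state of the projection. Transitions of \<open>ts\<close> before the next visible letter are
  hidden moves from \<open>R\<close>, and the others fall into the areas along
  \<open>ps\<close>.\<close>

lemma proj_tracks_path:
  assumes "wf_nfa A" "R \<subseteq> states A" "p \<in> hidden_reach_set A \<Gamma> R" "is_path A p ts q"
  shows "\<exists>ps S. is_path (proj A \<Gamma>) (hidden_reach_set A \<Gamma> R) ps S \<and>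
    map letter ps = filter (\<lambda>a. a \<in> \<Gamma>) (map letter ts) \<and> q \<in> S \<and> S \<subseteq> states A \<and>
    set ts \<subseteq> hidden_trans_set A \<Gamma> R \<union> (\<Union>t\<in>set ps. delta (area_of_trans A \<Gamma> t))"
  using assms(2-4)
proof (induction ts arbitrary: p R)
  case Nil
  then show ?case
    using hidden_reach_set_states[OF assms(1)] by (intro exI[of _ "[]"]) auto
next
  case (Cons t ts)
  obtain a p' where t: "t = (p, a, p')"
    using Cons.prems(3) by (cases t) (auto simp: source_def)
  then have path: "(p, a, p') \<in> delta A" "is_path A p' ts q"
    using Cons.prems(3) by (auto simp: target_def)
  show ?case
  proof (cases "a \<in> \<Gamma>")
    case False
    \<comment> \<open>\<open>hidden_trans_set\<close> is a union over seeds, so both ends of the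
      transition must be reached from one and the same seed \<open>r\<close>.\<close>
    obtain r where r: "r \<in> R" "p \<in> hidden_reach A \<Gamma> r"
      using Cons.prems(2) by (auto simp: hidden_reach_set_def)
    have a: "a \<in> alphabet A - \<Gamma>"
      using path(1) assms(1) False by (auto simp: wf_nfa_def)
    then have p': "p' \<in> hidden_reach A \<Gamma> r"
      using hidden_reach_step[OF r(2) path(1)] by simp
    then have "t \<in> hidden_trans_set A \<Gamma> R"
      using t path(1) r a by (auto simp: hidden_trans_set_def hidden_trans_def)
    moreover have "p' \<in> hidden_reach_set A \<Gamma> R"
      using p' r by (auto simp: hidden_reach_set_def)
    ultimately show ?thesis
      using Cons.IH[OF Cons.prems(1) _ path(2)] False t by simp
  next
    case True
    define S where "S = hidden_reach_set A \<Gamma> R"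
    \<comment> \<open>A visible letter resets the seeds to its direct successors.\<close>
    define R' where "R' = post_set A S a"
    have S: "S \<subseteq> states A"
      unfolding S_def by (rule hidden_reach_set_states[OF assms(1) Cons.prems(1)])
    have R': "R' \<subseteq> states A" "p' \<in> R'"
      using assms(1) path(1) Cons.prems(2)
      by (auto simp: R'_def S_def post_set_def post_def wf_nfa_def)
    have p': "p' \<in> hidden_reach_set A \<Gamma> R'"
      by (rule subsetD[OF subset_hidden_reach_set R'(2)])
    obtain ps S' where ps:
      "is_path (proj A \<Gamma>) (hidden_reach_set A \<Gamma> R') ps S'"
      "map letter ps = filter (\<lambda>a. a \<in> \<Gamma>) (map letter ts)" "q \<in> S'" "S' \<subseteq> states A"
      "set ts \<subseteq> hidden_trans_set A \<Gamma> R' \<union> (\<Union>t\<in>set ps. delta (area_of_trans A \<Gamma> t))"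
      using Cons.IH[OF R'(1) p' path(2)] by (elim exE conjE) (rule that)
    define T where "T = (S, a, hidden_reach_set A \<Gamma> R')"
    have "T \<in> delta (proj A \<Gamma>)"
      using S True by (simp add: T_def R'_def proj_def)
    \<comment> \<open>The hidden moves from \<open>R'\<close>, which the induction hypothesis leaves
      outside the areas along \<open>ps\<close>, are absorbed by the area of the new transition
      \<open>T\<close>.\<close>
    moreover have area: "delta (area_of_trans A \<Gamma> T) = letter_trans_set A S a \<union> hidden_trans_set A \<Gamma> R'"
      by (simp add: area_of_trans_def sub_automaton_def T_def R'_def source_def letter_def)
    moreover have "t \<in> letter_trans_set A S a"
      using t path(1) Cons.prems(2)
      by (auto simp: letter_trans_set_def letter_trans_def S_def post_def)
    ultimately show ?thesis
      using ps True t unfolding S_def[symmetric]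
      by (intro exI[of _ "T # ps"] exI[of _ S'])
        (auto simp: T_def)
  qed
qed

lemma hidden_reach_set_singleton [simp]: "hidden_reach_set A \<Gamma> {q} = hidden_reach A \<Gamma> q"
  by (simp add: hidden_reach_set_def)

lemma hidden_trans_set_singleton [simp]: "hidden_trans_set A \<Gamma> {q} = hidden_trans A \<Gamma> q"
  by (simp add: hidden_trans_set_def)

text \<open>The tracking lemma with the single seed \<open>q0\<close>: the leftover hidden moves are
  then the transitions of \<open>init_area\<close>, and the reached set is final because it contains
  \<open>q\<close>.\<close>

lemma proj_accepts_and_area_contains:
  assumes "wf_nfa A" "initials A = {q0}" "is_path A q0 ts q" "q \<in> finals A"
    and "filter (\<lambda>a. a \<in> \<Gamma>) (map letter ts) = w" "w \<in> lists \<Gamma>"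
  shows "w \<in> language (proj A \<Gamma>)" "set ts \<subseteq> delta (area_of_word A \<Gamma> w)"
proof -
  have q0: "init_state A = q0" "q0 \<in> states A"
    using assms(1,2) by (auto simp: init_state_def wf_nfa_def)
  have initials: "initials (proj A \<Gamma>) = {hidden_reach A \<Gamma> q0}"
    by (simp only: proj_def nfa.simps q0)
  then have init: "init_state (proj A \<Gamma>) = hidden_reach A \<Gamma> q0"
    by (simp only: init_state_def the_elem_eq)
  have start: "{q0} \<subseteq> states A" "q0 \<in> hidden_reach_set A \<Gamma> {q0}"
    using q0(2) subset_hidden_reach_set[of "{q0}" A \<Gamma>] by simp_all
  obtain ps S where ps: "is_path (proj A \<Gamma>) (hidden_reach A \<Gamma> q0) ps S"
    "map letter ps = w" "q \<in> S" "S \<subseteq> states A"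
    "set ts \<subseteq> hidden_trans A \<Gamma> q0 \<union> (\<Union>t\<in>set ps. delta (area_of_trans A \<Gamma> t))"
    using proj_tracks_path[OF assms(1) start assms(3)]
    unfolding hidden_reach_set_singleton hidden_trans_set_singleton assms(5)
    by (elim exE conjE) (rule that)
  have "S \<in> finals (proj A \<Gamma>)"
    using ps(3,4) assms(4) by (auto simp: proj_def)
  with ps(1,2) show "w \<in> language (proj A \<Gamma>)"
    unfolding language_def accepting_path_def initials by auto
  \<comment> \<open>Runs of the projection are unique, so the run found by tracking is the one that
    defines the area.\<close>
  have "proj_path A \<Gamma> w = ps"
    unfolding proj_path_def
    using ps(1,2) init by (intro the1_equality[OF proj_path_ex1[OF assms(1,2,6)]]) auto
  then show "set ts \<subseteq> delta (area_of_word A \<Gamma> w)"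
    using ps(5) q0(1) by (auto simp: area_of_word_def init_area_def Let_def)
qed

section \<open>Structure of the areas and of their intersection\<close>

lemma area_of_trans_simps:
  "states (area_of_trans A \<Gamma> t) = endpoints (delta (area_of_trans A \<Gamma> t))"
  "finals (area_of_trans A \<Gamma> t) = finals A \<inter> states (area_of_trans A \<Gamma> t)"
  "delta (area_of_trans A \<Gamma> t) \<subseteq> delta A"
  by (auto simp: area_of_trans_def sub_automaton_def letter_trans_set_def letter_trans_def
      post_def hidden_trans_set_def hidden_trans_def)

lemma init_area_simps:
  assumes "initials A = {q0}"
  shows "states (init_area A \<Gamma>) = insert q0 (endpoints (delta (init_area A \<Gamma>)))"
    and "finals (init_area A \<Gamma>) = finals A \<inter> states (init_area A \<Gamma>)"
    and "delta (init_area A \<Gamma>) \<subseteq> delta A"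
  using assms by (auto simp: init_area_def Let_def init_state_def hidden_trans_def)

lemma endpoints_UN: "endpoints (\<Union>x\<in>X. T x) = (\<Union>x\<in>X. endpoints (T x))"
  by (auto simp: endpoints_def)

text \<open>Every part has its states and finals determined by its transitions, up to
  \<open>q0\<close>, and this shape survives unions.\<close>

lemma area_of_word_simps:
  assumes "initials A = {q0}"
  shows "states (area_of_word A \<Gamma> w) = insert q0 (endpoints (delta (area_of_word A \<Gamma> w)))"
    and "finals (area_of_word A \<Gamma> w) = finals A \<inter> states (area_of_word A \<Gamma> w)"
    and "delta (area_of_word A \<Gamma> w) \<subseteq> delta A"
proof -
  define parts where
    "parts = insert (init_area A \<Gamma>) (area_of_trans A \<Gamma> ` set (proj_path A \<Gamma> w))"
  have area: "states (area_of_word A \<Gamma> w) = (\<Union>P\<in>parts. states P)"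
    "delta (area_of_word A \<Gamma> w) = (\<Union>P\<in>parts. delta P)"
    "finals (area_of_word A \<Gamma> w) = (\<Union>P\<in>parts. finals P)"
    by (simp_all only: area_of_word_def parts_def Let_def nfa.simps)
  \<comment> \<open>Inserting \<open>q0\<close> on both sides gives one equation for both kinds of
    parts: only \<open>init_area\<close> contains \<open>q0\<close> by convention.\<close>
  have part: "insert q0 (states P) = insert q0 (endpoints (delta P)) \<and>
      finals P = finals A \<inter> states P \<and> delta P \<subseteq> delta A" if "P \<in> parts" for P
  proof -
    from that consider "P = init_area A \<Gamma>" | t where "P = area_of_trans A \<Gamma> t"
      unfolding parts_def by blast
    then show ?thesis
    proof cases
      case 1
      then show ?thesis using init_area_simps[OF assms, of \<Gamma>] by simp
    next
      case (2 t)
      then show ?thesis using area_of_trans_simps[of A \<Gamma> t] by simp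
    qed
  qed
  have "init_area A \<Gamma> \<in> parts"
    by (simp add: parts_def)
  moreover from this have "q0 \<in> states (area_of_word A \<Gamma> w)"
    unfolding area(1) by (rule UN_I) (simp only: init_area_simps(1)[OF assms] insert_iff simp_thms)
  \<comment> \<open>One part already contains \<open>q0\<close>, so inserting it into all of them
    leaves the union unchanged.\<close>
  ultimately have "states (area_of_word A \<Gamma> w) = (\<Union>P\<in>parts. insert q0 (states P))"
    unfolding area(1) by blast
  also have "\<dots> = (\<Union>P\<in>parts. insert q0 (endpoints (delta P)))"
    using part by simp
  also have "\<dots> = insert q0 (endpoints (delta (area_of_word A \<Gamma> w)))"
    using \<open>init_area A \<Gamma> \<in> parts\<close> unfolding area(2) endpoints_UN by blast
  finally show "states (area_of_word A \<Gamma> w) = insert q0 (endpoints (delta (area_of_word A \<Gamma> w)))" .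
  have "finals (area_of_word A \<Gamma> w) = (\<Union>P\<in>parts. finals A \<inter> states P)"
    unfolding area(3) using part by simp
  then show "finals (area_of_word A \<Gamma> w) = finals A \<inter> states (area_of_word A \<Gamma> w)"
    unfolding area(1) by blast
  show "delta (area_of_word A \<Gamma> w) \<subseteq> delta A"
    unfolding area(2) using part by (intro UN_least) simp
qed

text \<open>Since \<open>n \<ge> 1\<close>, the intersections range over at least one area and
  inherit its bounds. For endpoints only an inclusion is claimed: a state may lie in all areas
  without touching a common transition.\<close>

lemma inter_nfa_simps:
  assumes "initials A = {q0}" "n \<ge> 1"
  shows "initials (inter_nfa A n \<Sigma> \<mu>) = {q0}" "q0 \<in> states (inter_nfa A n \<Sigma> \<mu>)"
    and "delta (inter_nfa A n \<Sigma> \<mu>) \<subseteq> delta A"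
    and "endpoints (delta (inter_nfa A n \<Sigma> \<mu>)) \<subseteq> states (inter_nfa A n \<Sigma> \<mu>)"
    and "finals (inter_nfa A n \<Sigma> \<mu>) = finals A \<inter> states (inter_nfa A n \<Sigma> \<mu>)"
proof -
  have ne: "1 \<in> {1..n}" using assms(2) by simp
  note area = area_of_word_simps[OF assms(1)]
  show "initials (inter_nfa A n \<Sigma> \<mu>) = {q0}"
    by (simp add: inter_nfa_def init_state_def assms(1))
  show "q0 \<in> states (inter_nfa A n \<Sigma> \<mu>)"
    by (simp add: inter_nfa_def area(1))
  show "delta (inter_nfa A n \<Sigma> \<mu>) \<subseteq> delta A"
    using area(3)[of "\<Sigma> 1" "\<mu> 1"] ne by (auto simp: inter_nfa_def)
  show "endpoints (delta (inter_nfa A n \<Sigma> \<mu>)) \<subseteq> states (inter_nfa A n \<Sigma> \<mu>)"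
    unfolding inter_nfa_def nfa.simps area(1) by (auto simp: endpoints_def)
  show "finals (inter_nfa A n \<Sigma> \<mu>) = finals A \<inter> states (inter_nfa A n \<Sigma> \<mu>)"
    unfolding inter_nfa_def nfa.simps area(2) using ne by auto
qed

section \<open>Runs of the central automaton\<close>

text \<open>Here \<open>f\<close> holds the words still to be read. Its entries stay suffixes of
  those of \<open>\<mu>\<close>, and the \<open>B\<close> component stays in
  \<open>states B\<close>, so every tuple met is a central state.\<close>

lemma central_path_of_interleave:
  assumes "set is = {1..n}" "distinct is"
    and "endpoints (delta B) \<subseteq> states B" "p \<in> states B" "is_path B p ts q"
    and "\<And>i. i \<in> {1..n} \<Longrightarrow> suffix (f i) (\<mu> i)" "map letter ts \<in> interleave is f"
  shows "\<exists>us. is_path (central_nfa B n \<mu>) (restrict f {1..n}, p) us (\<lambda>i\<in>{1..n}. [], q)"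
  using assms(4-)
proof (induction ts arbitrary: p f)
  case Nil
  then have "restrict f {1..n} = (\<lambda>i\<in>{1..n}. [])"
    using assms(1) by (intro restrict_ext) (auto simp: Nil_in_interleave_iff)
  with Nil.prems(2) show ?case by (metis is_path.simps(1))
next
  case (Cons t ts)
  obtain a p' where t: "t = (p, a, p')"
    using Cons.prems(2) by (cases t) (auto simp: source_def)
  then have path: "(p, a, p') \<in> delta B" "is_path B p' ts q"
    using Cons.prems(2) by (auto simp: target_def)
  have p': "p' \<in> states B"
    using path(1) assms(3) by (force simp: endpoints_def target_def)
  have "a # map letter ts \<in> interleave is f"
    using Cons.prems(4) t by simp
  \<comment> \<open>The component supplying the letter is the one that the central transition will
    shorten.\<close>
  then obtain i v where i: "i \<in> {1..n}" "f i = a # v" "map letter ts \<in> interleave is (f(i := v))"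
    using assms(1) unfolding Cons_in_interleave_iff[OF assms(2)] by blast
  define f' where "f' = f(i := v)"
  have suf: "suffix (f' j) (\<mu> j)" if "j \<in> {1..n}" for j
    using Cons.prems(3)[OF that] i(2) by (auto simp: f'_def dest: suffix_ConsD)
  define g where "g = restrict f {1..n}"
  define g' where "g' = restrict f' {1..n}"
  have "g \<in> (\<Pi>\<^sub>E i\<in>{1..n}. {v. suffix v (\<mu> i)})" "g' \<in> (\<Pi>\<^sub>E i\<in>{1..n}. {v. suffix v (\<mu> i)})"
    using Cons.prems(3) suf by (simp_all add: g_def g'_def)
  moreover have "g i = a # g' i" "\<forall>j\<in>{1..n}. j \<noteq> i \<longrightarrow> g j = g' j"
    using i(1,2) by (simp_all add: g_def g'_def f'_def)
  ultimately have "((g, p), a, (g', p')) \<in> delta (central_nfa B n \<mu>)"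
    using Cons.prems(1) p' path(1) i(1) by (auto simp: central_nfa_def Let_def post_def)
  moreover obtain us where "is_path (central_nfa B n \<mu>) (g', p') us (\<lambda>i\<in>{1..n}. [], q)"
    using Cons.IH[OF p' path(2) suf] i(3) unfolding f'_def g'_def by blast
  ultimately have
    "is_path (central_nfa B n \<mu>) (g, p) (((g, p), a, (g', p')) # us) (\<lambda>i\<in>{1..n}. [], q)"
    unfolding is_path.simps triple_simps by (intro conjI refl)
  then show ?case unfolding g_def by (rule exI)
qed

text \<open>Forgetting the tuples turns a central run into a path of \<open>B\<close>; the shortened
  components record how its letters interleave.\<close>

lemma interleave_of_central_path:
  assumes "set is = {1..n}" "distinct is"
    and "is_path (central_nfa B n \<mu>) (f, p) us (g, q)" "\<And>i. i \<in> {1..n} \<Longrightarrow> g i = []"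
  shows "\<exists>ts. is_path B p ts q \<and> map letter ts \<in> interleave is f"
  using assms(3)
proof (induction us arbitrary: f p)
  case Nil
  then have "[] \<in> interleave is f"
    using assms(1,4) by (simp add: Nil_in_interleave_iff)
  with Nil show ?case by (intro exI[of _ "[]"]) simp
next
  case (Cons u us)
  then obtain a f' p' where u: "u = ((f, p), a, (f', p'))"
    by (cases u) (auto simp: source_def)
  with Cons.prems have path: "is_path (central_nfa B n \<mu>) (f', p') us (g, q)"
    and "u \<in> delta (central_nfa B n \<mu>)"
    by (simp_all add: target_def)
  then obtain i where i: "(p, a, p') \<in> delta B" "i \<in> {1..n}" "f i = a # f' i"
      "\<And>j. j \<in> {1..n} \<Longrightarrow> j \<noteq> i \<Longrightarrow> f j = f' j"
    using u by (auto simp: central_nfa_def Let_def post_def)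
  obtain ts where ts: "is_path B p' ts q" "map letter ts \<in> interleave is f'"
    using Cons.IH[OF path] by blast
  \<comment> \<open>A central transition fixes the other components only on \<open>{1..n}\<close>,
    so \<open>f'\<close> and the update of \<open>f\<close> may differ elsewhere;
    \<open>interleave\<close> sees only the listed indices.\<close>
  have "interleave is (f(i := f' i)) = interleave is f'"
    using i(4) assms(1) by (intro interleave_cong) auto
  with ts(2) i(2,3) have "a # map letter ts \<in> interleave is f"
    unfolding Cons_in_interleave_iff[OF assms(2)] assms(1) by blast
  with ts(1) i(1) show ?case
    by (intro exI[of _ "(p, a, p') # ts"]) simp
qed

lemma central_reaches_final_iff:
  assumes "endpoints (delta B) \<subseteq> states B" "initials B = {p}" "p \<in> states B"
  shows "reachable (central_nfa B n \<mu>) \<inter> finals (central_nfa B n \<mu>) \<noteq> {} \<longleftrightarrow>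
    interleavings n \<mu> \<inter> language B \<noteq> {}"
proof -
  have indices: "set [1..<Suc n] = {1..n}" by auto
  have "interleave [1..<Suc n] (restrict \<mu> {1..n}) = interleave [1..<Suc n] \<mu>"
    by (intro interleave_cong) auto
  then have path_iff: "(\<exists>us. is_path (central_nfa B n \<mu>) (restrict \<mu> {1..n}, p) us (\<lambda>i\<in>{1..n}. [], q)) \<longleftrightarrow>
      (\<exists>ts. is_path B p ts q \<and> map letter ts \<in> interleavings n \<mu>)" for q
    using central_path_of_interleave[OF indices distinct_upt assms(1,3), of _ q \<mu> \<mu>]
      interleave_of_central_path[OF indices distinct_upt,
        of B \<mu> "restrict \<mu> {1..n}" p _ "\<lambda>i\<in>{1..n}. []" q]
    unfolding interleavings_eq by (metis restrict_apply' suffix_order.refl)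
  define start stop :: "nat \<Rightarrow> 'b list" where "start = restrict \<mu> {1..n}" and "stop = (\<lambda>i\<in>{1..n}. [])"
  have "initials (central_nfa B n \<mu>) = {(start, p)}"
    "finals (central_nfa B n \<mu>) = {stop} \<times> finals B"
    by (simp_all add: central_nfa_def Let_def init_state_def assms(2) start_def stop_def)
  then have "reachable (central_nfa B n \<mu>) \<inter> finals (central_nfa B n \<mu>) \<noteq> {} \<longleftrightarrow>
      (\<exists>q\<in>finals B. \<exists>us. is_path (central_nfa B n \<mu>) (start, p) us (stop, q))"
    by (auto simp: reachable_def)
  also have "\<dots> \<longleftrightarrow> interleavings n \<mu> \<inter> language B \<noteq> {}"
    unfolding start_def stop_def path_iff
    using assms(2) by (auto simp: language_def accepting_path_def)
  finally show ?thesis .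
qed

section \<open>Transfer between the automaton and the intersection\<close>

lemma language_inter_nfa_subset:
  assumes "initials A = {q0}" "n \<ge> 1"
  shows "language (inter_nfa A n \<Sigma> \<mu>) \<subseteq> language A"
proof
  note inter = inter_nfa_simps[OF assms, of \<Sigma> \<mu>]
  fix w assume "w \<in> language (inter_nfa A n \<Sigma> \<mu>)"
  then obtain ts q where ts: "w = map letter ts" "is_path (inter_nfa A n \<Sigma> \<mu>) q0 ts q"
      "q \<in> finals A"
    using inter by (auto simp: language_def accepting_path_def)
  then have "is_path A q0 ts q"
    using is_path_mono[OF _ subset_trans[OF is_path_delta inter(3)]] by blast
  with ts show "w \<in> language A"
    using assms(1) by (auto simp: language_def accepting_path_def)
qed

text \<open>An accepted interleaving refutes every error: the first conclusion excludes
  \<open>LocalError\<close>, the second excludes \<open>InterError\<close> and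
  \<open>CentralError\<close>.\<close>

lemma accepted_interleaving:
  assumes "n \<ge> 1" "wf_nfa A" "initials A = {q0}" "disjoint_family_on \<Sigma> {1..n}"
    and \<mu>: "\<And>i. i \<in> {1..n} \<Longrightarrow> \<mu> i \<in> lists (\<Sigma> i)"
    and w: "w \<in> interleavings n \<mu>" "w \<in> language A"
  shows "i \<in> {1..n} \<Longrightarrow> \<mu> i \<in> language (proj A (\<Sigma> i))"
    and "w \<in> language (inter_nfa A n \<Sigma> \<mu>)"
proof -
  obtain ts q where ts: "w = map letter ts" "is_path A q0 ts q" "q \<in> finals A"
    using w(2) assms(3) by (auto simp: language_def accepting_path_def)
  have "filter (\<lambda>a. a \<in> \<Sigma> i) (map letter ts) = \<mu> i" if "i \<in> {1..n}" for i
  proof -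
    have "set [1..<Suc n] = {1..n}" by auto
    with that show ?thesis
      using filter_interleave[of w "[1..<Suc n]" \<mu> \<Sigma> i] w(1) assms(4) \<mu>
      unfolding interleavings_eq ts(1) by (metis distinct_upt)
  qed
  note local = proj_accepts_and_area_contains[OF assms(2,3) ts(2,3) this \<mu>]
  show "\<mu> i \<in> language (proj A (\<Sigma> i))" if "i \<in> {1..n}"
    using local(1) that by blast
  let ?I = "inter_nfa A n \<Sigma> \<mu>"
  note inter = inter_nfa_simps[OF assms(3,1), of \<Sigma> \<mu>]
  \<comment> \<open>One path \<open>ts\<close> serves all locations: it lies in each area, hence in
    the intersection.\<close>
  have sub: "set ts \<subseteq> delta ?I"
    unfolding inter_nfa_def using local(2) by force
  have "q \<in> states ?I"
    using is_path_end[OF ts(2)] sub inter(2,4) unfolding endpoints_def by blast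
  then show "w \<in> language ?I"
    using ts inter(1,5) is_path_mono[OF ts(2) sub]
    by (auto simp: language_def accepting_path_def)
qed

theorem mainTheorem2:
  fixes A :: "('q, 'a) nfa" and q0 :: 'q
    and n :: nat and \<Sigma> :: "nat \<Rightarrow> 'a set" and \<mu> :: "nat \<Rightarrow> 'a list"
  assumes "n \<ge> 2"
    and "wf_nfa A"
    and "initials A = {q0}"
    and "alphabet A = (\<Union>i\<in>{1..n}. \<Sigma> i)"
    and "disjoint_family_on \<Sigma> {1..n}"
    and "\<And>i. i \<in> {1..n} \<Longrightarrow> \<mu> i \<in> lists (\<Sigma> i)"
  shows "(\<forall>v. semi_centralized A n \<Sigma> \<mu> v \<and> is_error v \<longrightarrow>
                interleavings n \<mu> \<inter> language A = {})
       \<and> (interleavings n \<mu> \<inter> language A = {} \<longrightarrow>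
                (\<exists>v. semi_centralized A n \<Sigma> \<mu> v) \<and>
                (\<forall>v. semi_centralized A n \<Sigma> \<mu> v \<longrightarrow> is_error v))"
proof -
  let ?I = "inter_nfa A n \<Sigma> \<mu>"
  have n: "n \<ge> 1" using assms(1) by simp
  note inter = inter_nfa_simps[OF assms(3) n, of \<Sigma> \<mu>]
  note accepted = accepted_interleaving[OF n assms(2,3,5,6)]
  \<comment> \<open>\<open>InterError\<close> needs no separate treatment: without an accepting path
    the language of \<open>?I\<close> is empty, so the right-hand side fails as well.\<close>
  have "central_check A n \<Sigma> \<mu> = Pass \<longleftrightarrow> interleavings n \<mu> \<inter> language ?I \<noteq> {}"
    unfolding central_check_def Let_def central_reaches_final_iff[OF inter(4,1,2)]
    by (auto simp: language_def)
  also have "\<dots> \<longleftrightarrow> interleavings n \<mu> \<inter> language A \<noteq> {}"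
    using accepted(2) language_inter_nfa_subset[OF assms(3) n] by blast
  finally have pass: "central_check A n \<Sigma> \<mu> = Pass \<longleftrightarrow> interleavings n \<mu> \<inter> language A \<noteq> {}" .
  have error: "is_error v \<longleftrightarrow> v \<noteq> Pass" for v
    by (cases v) (auto simp: is_error_def)
  \<comment> \<open>Soundness and completeness are the two directions of this equivalence, which
    holds for every verdict the relation allows.\<close>
  have "is_error v \<longleftrightarrow> interleavings n \<mu> \<inter> language A = {}" if "semi_centralized A n \<Sigma> \<mu> v" for v
    using that
  proof cases
    case (local_error i)
    then show ?thesis using accepted(1) by (auto simp: is_error_def)
  next
    case central
    then show ?thesis using pass error by simp
  qed
  then show ?thesis using semi_centralized_total by blast
qed

end
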